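(* For each $n\ge 3$ let $b_n$ be the number of permutations $\pi\in S_n^1(1\text{-}23)$ for which $(1\text{-}2\text{-}3)\pi=1$, i.e. the permutations of length $n$ that contain exactly one occurrence of the pattern $(1\text{-}23)$ and exactly one occurrence of the pattern $(1\text{-}2\text{-}3)$. Then, as formal power series, $$\sum_{n\ge 3} b_n x^n = x^3 C(x)^5=\sum_{n\ge 3}\frac{5}{n+2}\binom{2n-2}{n+1}x^n.$$
   Context: Let $\pi=\pi_1\pi_2\cdots\pi_n$ be a permutation of $\{1,\ldots,n\}$. An occurrence of the pattern $(1\text{-}2\text{-}3)$ in $\pi$ is a triple of positions $i<j<m$ with $\pi_i<\pi_j<\pi_m$. An occurrence of the pattern $(1\text{-}23)$ in $\pi$ is such a triple in which the last two positions are adjacent, i.e. $m=j+1$. For a pattern $q$, $(q)\pi$ denotes the number of occurrences of $q$ in $\pi$, and $S_n^k(q)$ denotes the set of permutations of length $n$ containing exactly $k$ occurrences of $q$. $C(x)=\frac{1-\sqrt{1-4x}}{2x}=\sum_{n\ge 0}\frac{1}{n+1}\binom{2n}{n}x^n$ is the Catalan generating function. *)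

theory Defs
  imports Complex_Main
    "HOL-Combinatorics.Permutations"
    "HOL-Computational_Algebra.Formal_Power_Series"
begin

text \<open>
  A permutation \<open>\<pi>\<close> of length \<open>n\<close> is a function \<open>p\<close> with \<open>p permutes {1..n}\<close>,
  and \<open>\<pi>\<^sub>i\<close> is \<open>p i\<close>.  Positions are 1-based.
\<close>

definition occ_1_2_3 :: "nat \<Rightarrow> (nat \<Rightarrow> nat) \<Rightarrow> nat" where
  "occ_1_2_3 n p = card {(i, j, m). 1 \<le> i \<and> i < j \<and> j < m \<and> m \<le> n \<and> p i < p j \<and> p j < p m}"

definition occ_1_23 :: "nat \<Rightarrow> (nat \<Rightarrow> nat) \<Rightarrow> nat" where
  "occ_1_23 n p =
     card {(i, j, m). 1 \<le> i \<and> i < j \<and> j < m \<and> m \<le> n \<and> p i < p j \<and> p j < p m \<and> m = j + 1}"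

text \<open>The set \<open>S\<^sub>n\<^sup>k(q)\<close>, where the pattern \<open>q\<close> is given by its occurrence-counting function.\<close>

definition perms_with_occ :: "nat \<Rightarrow> nat \<Rightarrow> (nat \<Rightarrow> (nat \<Rightarrow> nat) \<Rightarrow> nat) \<Rightarrow> (nat \<Rightarrow> nat) set" where
  "perms_with_occ n k q = {p. p permutes {1..n} \<and> q n p = k}"

definition catalan_fps :: "real fps" where
  "catalan_fps = Abs_fps (\<lambda>n. 1 / real (n + 1) * real ((2 * n) choose n))"

text \<open>
  The remaining lemmas confirm the closed form \<open>C(x) = (1 - sqrt (1 - 4x)) / (2x)\<close> of
  \<^const>\<open>catalan_fps\<close>.  They are not used in any definition.
\<close>

lemma central_binomial_Suc:
  "real (n + 1) * real ((2 * Suc n) choose (Suc n)) = 2 * (2 * real n + 1) * real ((2 * n) choose n)"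
proof -
  let ?f = "fact n :: real" and ?g = "fact (2 * n) :: real"
  have "real ((2 * Suc n) choose (Suc n)) = fact (2 * Suc n) / (fact (Suc n) * fact (Suc n))"
    using binomial_fact[of "Suc n" "2 * Suc n", where 'a = real] by (simp only: mult_2) simp
  also have "fact (2 * Suc n) = (2 * real n + 2) * ((2 * real n + 1) * ?g)"
    by (simp add: algebra_simps)
  also have "fact (Suc n) = (real n + 1) * ?f"
    by (simp add: algebra_simps)
  finally have 1: "real ((2 * Suc n) choose (Suc n)) =
    (2 * real n + 2) * ((2 * real n + 1) * ?g) / ((real n + 1) * ?f * ((real n + 1) * ?f))" .
  have 2: "real ((2 * n) choose n) = ?g / (?f * ?f)"
    using binomial_fact[of n "2 * n", where 'a = real] by simp
  have "real n + 1 \<noteq> 0" "?f \<noteq> 0"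
    by simp_all
  then show ?thesis
    unfolding 1 2 by (simp add: divide_simps) algebra
qed

lemma half_gchoose_Suc:
  "((1 / 2 :: real) gchoose Suc n) * (- 4) ^ Suc n = - 2 / real (n + 1) * real ((2 * n) choose n)"
proof (induction n)
  case 0
  show ?case by simp
next
  case (Suc n)
  let ?g = "\<lambda>k. ((1 / 2 :: real) gchoose k) * (- 4) ^ k"
  have *: "real (n + 2) * ((1 / 2 :: real) gchoose Suc (Suc n)) =
      (1 / 2 - real (Suc n)) * ((1 / 2 :: real) gchoose Suc n)"
    using gbinomial_mult_1[of "1 / 2 :: real" "Suc n"] by (simp add: algebra_simps)
  have "real (n + 2) * ?g (Suc (Suc n)) =
      real (n + 2) * ((1 / 2 :: real) gchoose Suc (Suc n)) * (- 4) ^ Suc (Suc n)"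
    by (simp only: mult.assoc)
  also have "\<dots> = (- 4) * (1 / 2 - real (Suc n)) * ?g (Suc n)"
    unfolding * by (simp only: power_Suc mult_ac)
  also have "\<dots> = - 4 * (2 * real n + 1) * real ((2 * n) choose n) / real (n + 1)"
    unfolding Suc.IH by (simp add: field_simps)
  also have "\<dots> = - 2 * real ((2 * Suc n) choose (Suc n))"
    using central_binomial_Suc[of n] by (simp add: field_simps del: binomial_Suc_Suc mult_Suc_right)
  finally show ?case
    by (simp add: field_simps del: binomial_Suc_Suc mult_Suc_right power_Suc)
qed

lemma catalan_fps_closed_form:
  includes fps_syntax
  shows "2 * fps_X * catalan_fps = 1 - fps_radical root 2 (1 - 4 * fps_X)"
proof -
  define S :: "real fps" where "S = Abs_fps (\<lambda>n. ((1 / 2) gchoose n) * (- 4) ^ n)"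
  have "S ^ 2 = 1 - 4 * fps_X"
  proof (rule fps_ext)
    fix n
    have "(S ^ 2) $ n = (\<Sum>k=0..n. ((1/2) gchoose k) * ((1/2) gchoose (n - k)) * (- 4) ^ n)"
      unfolding power2_eq_square fps_mult_nth S_def
      by (intro sum.cong refl) (simp add: mult_ac flip: power_add)
    also have "\<dots> = ((1 :: real) gchoose n) * (- 4) ^ n"
      using gbinomial_Vandermonde[of "1/2 :: real" "1/2" n]
      by (simp add: atLeast0AtMost flip: sum_distrib_right)
    also have "\<dots> = (1 - 4 * fps_X :: real fps) $ n"
    proof -
      have "(1 :: real) gchoose n = real (1 choose n)"
        using binomial_gbinomial[of 1 n, where 'a = real] by simp
      moreover have "(4 * fps_X :: real fps) $ n = (if n = 1 then 4 else 0)"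
        by (cases n) (simp_all add: numeral_fps_const)
      ultimately show ?thesis
        by (cases "n = 0"; cases "n = 1") (auto simp: binomial_eq_0)
    qed
    finally show "(S ^ 2) $ n = (1 - 4 * fps_X) $ n" .
  qed
  then have "S = fps_radical root 2 (1 - 4 * fps_X)"
    using radical_unique[of root 1 "1 - 4 * fps_X" S]
    by (simp add: S_def numeral_2_eq_2 numeral_fps_const)
  moreover have "2 * fps_X * catalan_fps = 1 - S"
  proof (rule fps_ext)
    fix n
    show "(2 * fps_X * catalan_fps) $ n = (1 - S) $ n"
    proof (cases n)
      case 0
      then show ?thesis by (simp add: S_def)
    next
      case (Suc m)
      have "(2 * fps_X * catalan_fps) $ n = 2 * catalan_fps $ m"
        by (simp add: Suc numeral_fps_const mult.assoc)
      then show ?thesis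
        using half_gchoose_Suc[of m] by (simp add: Suc S_def catalan_fps_def)
    qed
  qed
  ultimately show ?thesis by simp
qed

end

theory Submission
  imports Defs "HOL-Combinatorics.Multiset_Permutations"
begin

text \<open>
  Remove the first entry \<open>y\<close> of a permutation of a finite set \<open>S\<close> of \<open>n\<close> numbers: the occurrences of
  1-2-3 that start at \<open>y\<close> are the ascending pairs among the later entries exceeding \<open>y\<close>. Hence one
  counts permutations together with the behaviour of their top \<open>k\<close> entries, those above a threshold,
  and only ranks matter. If the top \<open>k\<close> entries are required to be decreasing, the permutations
  avoiding 1-2-3 have generating function \<open>G\<^sub>k = x\<^sup>k C\<^bsup>k+1\<^esup>\<close>, because the recurrence obtained amounts to
  \<open>G\<^sub>k = x G\<^bsub>k-1\<^esub> + x (G\<^sub>k + G\<^bsub>k+1\<^esub> + \<dots>)\<close>, whose sum telescopes by \<open>C = 1 + x C\<^sup>2\<close>.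
  The unique occurrence in a counted permutation starts either later than \<open>y\<close>, which gives a recurrence
  of the same shape, or at \<open>y\<close>; then the rest avoids 1-2-3 and has exactly one ascending pair above \<open>y\<close>,
  with adjacent positions. With the top \<open>k\<close> decreasing and the top \<open>r\<close> containing exactly one such
  pair, the latter are counted by \<open>x\<^sup>r (C + \<dots> + C\<^bsup>r-max(k,1)\<^esup>)\<close>. The resulting recurrence is
  solved by \<open>x\<^bsup>k+1\<^esup> C\<^sup>2 ((1 - x) C\<^bsup>k+1\<^esup> - 1)\<close>, which for \<open>k = 0\<close> is \<open>x\<^sup>3 C\<^sup>5\<close>.
\<close>

section \<open>Catalan series: telescoping sums and recurrences\<close>

unbundle fps_syntax

abbreviation (input) C :: "real fps" where "C \<equiv> catalan_fps"
abbreviation (input) X :: "real fps" where "X \<equiv> fps_X"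

text \<open>The closed form gives \<open>2 * X * C = 1 - ?S\<close> with
  \<open>?S ^ 2 = 1 - 4 * X\<close>. Squaring yields the claim multiplied by \<open>4 * X\<close>,
  which can be cancelled in an integral domain.\<close>

lemma catalan_fps_quadratic: "C = 1 + X * C ^ 2"
proof -
  let ?S = "fps_radical root 2 (1 - 4 * X)"
  have "(1 - 4 * X) $ 0 = 1" by (simp add: numeral_fps_const)
  then have "?S ^ 2 = 1 - 4 * X"
    using power_radical[of "1 - 4 * X" root 1] by (simp add: numeral_2_eq_2)
  moreover have "?S = 1 - 2 * X * C" using catalan_fps_closed_form by simp
  ultimately have "4 * X * (1 + X * C ^ 2 - C) = 0" by algebra
  moreover have "4 * X \<noteq> 0" by simp
  ultimately have "1 + X * C ^ 2 - C = 0" using mult_eq_0_iff by blast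
  then show ?thesis by simp
qed

lemma catalan_fps_power_Suc: "C ^ Suc j = C ^ j + X * C ^ (j + 2)"
proof -
  have "C ^ Suc j = C ^ j * (1 + X * C ^ 2)"
    unfolding catalan_fps_quadratic[symmetric] by (simp add: mult.commute)
  also have "\<dots> = C ^ j + X * C ^ (j + 2)"
    by (simp add: algebra_simps power_add power2_eq_square)
  finally show ?thesis .
qed

definition avoid_fps :: "nat \<Rightarrow> real fps" where
  "avoid_fps k = X ^ k * C ^ Suc k"

text \<open>The bound \<open>max k 1\<close> makes \<open>k = 0\<close> and \<open>k = 1\<close>
  agree: a top part with at most one entry is always decreasing. For \<open>r \<le> max k 1\<close>
  the sum is empty, since then no ascending pair fits into the top \<open>r\<close> entries.\<close>

definition pair_fps :: "nat \<Rightarrow> nat \<Rightarrow> real fps" where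
  "pair_fps r k = X ^ r * (\<Sum>j=1..r - max k 1. C ^ j)"

definition single_fps :: "nat \<Rightarrow> real fps" where
  "single_fps k = X ^ Suc k * C ^ 2 * ((1 - X) * C ^ Suc k - 1)"

lemma avoid_fps_0: "avoid_fps 0 = 1 + X * C ^ 2"
  unfolding avoid_fps_def using catalan_fps_quadratic by simp

lemma fps_X_power_mult_nth_less: "n < k \<Longrightarrow> (X ^ k * f) $ n = 0"
  by (simp add: fps_X_power_mult_nth)

text \<open>By \<open>catalan_fps_power_Suc\<close> each summand is a difference of consecutive
  terms. Stopping at \<open>r = n\<close> loses nothing, because the boundary term is divisible by
  \<open>X ^ Suc n\<close>.\<close>

lemma sum_nth_telescope:
  assumes "k \<le> Suc n"
  shows "(\<Sum>r=k..n. (X ^ r * C ^ (r - k + i) * f) $ n) = (X ^ k * C ^ Suc i * f) $ n"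
proof -
  define g where "g r = - (X ^ r * C ^ (r - k + Suc i) * f) $ n" for r
  have "(X ^ r * C ^ (r - k + i) * f) $ n = g (Suc r) - g r" if "r \<in> {k..n}" for r
  proof -
    have "X ^ r * C ^ (r - k + i) * f = X ^ r * C ^ Suc (r - k + i) * f - X ^ Suc r * C ^ Suc (Suc (r - k + i)) * f"
      unfolding catalan_fps_power_Suc[of "r - k + i"] by (simp add: algebra_simps)
    then show ?thesis using that by (simp add: g_def Suc_diff_le)
  qed
  then have "(\<Sum>r=k..n. (X ^ r * C ^ (r - k + i) * f) $ n) = (\<Sum>r=k..n. g (Suc r) - g r)"
    by (intro sum.cong) auto
  also have "\<dots> = g (Suc n) - g k"
    using assms by (rule sum_Suc_diff)
  also have "g (Suc n) = 0"
    by (simp add: g_def mult.assoc fps_X_power_mult_nth_less del: power_Suc)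
  finally show ?thesis by (simp add: g_def)
qed

lemma sum_avoid_fps_nth:
  assumes "k \<le> Suc n"
  shows "(\<Sum>r=k..n. (avoid_fps r * f) $ n) = (X ^ k * C ^ (k + 2) * f) $ n"
proof -
  have "(\<Sum>r=k..n. (avoid_fps r * f) $ n) = (\<Sum>r=k..n. (X ^ r * C ^ (r - k + Suc k) * f) $ n)"
    unfolding avoid_fps_def by (intro sum.cong) auto
  also have "\<dots> = (X ^ k * C ^ (k + 2) * f) $ n"
    using sum_nth_telescope[OF assms, of "Suc k" f] by simp
  finally show ?thesis .
qed

text \<open>For \<open>k > 0\<close> this is \<open>C ^ Suc k = C ^ k + X * C ^ (k + 2)\<close>
  multiplied by \<open>X ^ k\<close>; the last term is \<open>X\<close> times the telescoped sum.
  For \<open>k = 0\<close> the constant in \<open>C = 1 + X * C ^ 2\<close> is invisible at index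
  \<open>Suc n\<close>.\<close>

lemma avoid_fps_rec:
  assumes "k \<le> Suc n"
  shows "avoid_fps k $ Suc n =
    (if 0 < k then avoid_fps (k - 1) $ n else 0) + (\<Sum>r=k..n. avoid_fps r $ n)"
proof -
  have *: "(\<Sum>r=k..n. avoid_fps r $ n) = (X ^ k * C ^ (k + 2)) $ n"
    using sum_avoid_fps_nth[OF assms, of 1] by simp
  show ?thesis
  proof (cases k)
    case 0
    then show ?thesis unfolding * by (simp add: avoid_fps_0 power2_eq_square)
  next
    case (Suc j)
    have "avoid_fps k = X * avoid_fps j + X * (X ^ k * C ^ (k + 2))"
      unfolding avoid_fps_def catalan_fps_power_Suc[of k] by (simp add: Suc algebra_simps)
    then have "avoid_fps k $ Suc n = avoid_fps j $ n + (X ^ k * C ^ (k + 2)) $ n"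
      by simp
    then show ?thesis unfolding * by (simp add: Suc)
  qed
qed

text \<open>This cancels the terms \<open>- X ^ Suc k * C ^ 2\<close> of \<^const>\<open>single_fps\<close> against
  \<^const>\<open>pair_fps\<close> in the recurrence for single occurrences.\<close>

lemma sum_pair_fps_nth:
  assumes "k \<le> Suc n" "1 \<le> k"
  shows "(\<Sum>r=k..n. pair_fps r k $ n) = (\<Sum>r=k..n. (X ^ Suc r * C ^ 2) $ n)"
  using assms
proof (induction k rule: inc_induct)
  case base
  then show ?case by simp
next
  case (step k)
  have k: "k \<le> n" "1 \<le> k" using step by auto
  \<comment> \<open>Lowering \<open>Suc k\<close> to \<open>k\<close> adds one power of
    \<open>C\<close> to each series. These powers telescope to \<open>X ^ Suc k * C ^ 2\<close>, the
    new summand \<open>r = k\<close> on the right-hand side.\<close>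
  have "pair_fps r k = pair_fps r (Suc k) + X ^ r * C ^ (r - k)" if "r \<in> {Suc k..n}" for r
  proof -
    have "r - k = Suc (r - Suc k)" using that by auto
    then show ?thesis using k by (simp add: pair_fps_def max_def algebra_simps)
  qed
  then have "(\<Sum>r=Suc k..n. pair_fps r k $ n) =
      (\<Sum>r=Suc k..n. pair_fps r (Suc k) $ n + (X ^ r * C ^ (r - k)) $ n)"
    by (intro sum.cong) auto
  also have "\<dots> = (\<Sum>r=Suc k..n. (X ^ Suc r * C ^ 2) $ n) + (\<Sum>r=Suc k..n. (X ^ r * C ^ (r - k)) $ n)"
    using step by (simp add: sum.distrib)
  also have "(\<Sum>r=Suc k..n. (X ^ r * C ^ (r - k)) $ n) =
      (\<Sum>r=Suc k..n. (X ^ r * C ^ (r - Suc k + 1) * 1) $ n)"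
    by (intro sum.cong) (auto simp: Suc_diff_Suc)
  also have "\<dots> = (X ^ Suc k * C ^ 2) $ n"
    using sum_nth_telescope[of "Suc k" n 1 1] k by (simp add: numeral_2_eq_2)
  finally have "(\<Sum>r=Suc k..n. pair_fps r k $ n) = (\<Sum>r=k..n. (X ^ Suc r * C ^ 2) $ n)"
    using k by (simp add: sum.atLeast_Suc_atMost[of k n])
  moreover have "pair_fps k k = 0" using k by (simp add: pair_fps_def)
  ultimately show ?case using k by (simp add: sum.atLeast_Suc_atMost[of k n "\<lambda>r. pair_fps r k $ n"])
qed

text \<open>All these are polynomial identities modulo the quadratic equation for \<open>C\<close>.
  The second one reflects that a top part of size 0 or 1 imposes the same condition.\<close>

lemma single_fps_0: "single_fps 0 = X ^ 3 * C ^ 5"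
  and single_fps_0_eq_1: "single_fps 0 = single_fps 1"
proof -
  have "C = 1 + X * C ^ 2" by (rule catalan_fps_quadratic)
  then show "single_fps 0 = X ^ 3 * C ^ 5" "single_fps 0 = single_fps 1"
    unfolding single_fps_def One_nat_def power_Suc power_0 by algebra+
qed

lemma single_fps_rec:
  assumes "k \<le> Suc n"
  shows "single_fps k $ Suc n = (if 0 < k then single_fps (k - 1) $ n else 0)
    + (\<Sum>r=k..n. single_fps r $ n + pair_fps r k $ n)"
proof -
  have pos: "single_fps k $ Suc n = single_fps (k - 1) $ n
    + (\<Sum>r=k..n. single_fps r $ n + pair_fps r k $ n)" if k: "k \<le> Suc n" "0 < k" for k
  proof -
    obtain j where j: "k = Suc j" using k by (cases k) auto
    let ?f = "(1 - X) * X * C ^ 2"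
    \<comment> \<open>The multiples of \<open>avoid_fps r\<close> telescope, while the subtracted
      terms cancel against the sum of the pair series.\<close>
    have "single_fps r = avoid_fps r * ?f - X ^ Suc r * C ^ 2" for r
      by (simp add: single_fps_def avoid_fps_def algebra_simps)
    then have "(\<Sum>r=k..n. single_fps r $ n + pair_fps r k $ n) = (\<Sum>r=k..n. (avoid_fps r * ?f) $ n)
      - (\<Sum>r=k..n. (X ^ Suc r * C ^ 2) $ n) + (\<Sum>r=k..n. pair_fps r k $ n)"
      by (simp add: sum.distrib sum_subtractf)
    also have "\<dots> = (X ^ k * C ^ (k + 2) * ?f) $ n"
      using k by (simp only: sum_pair_fps_nth sum_avoid_fps_nth)
    finally have s: "(\<Sum>r=k..n. single_fps r $ n + pair_fps r k $ n) = (X ^ k * C ^ (k + 2) * ?f) $ n" .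
    have "single_fps k = X * single_fps j + X * (X ^ k * C ^ (k + 2) * ?f)"
      unfolding single_fps_def catalan_fps_power_Suc[of k] by (simp add: j algebra_simps)
    then have "single_fps k $ Suc n = single_fps j $ n + (X ^ k * C ^ (k + 2) * ?f) $ n"
      by simp
    then show ?thesis unfolding s by (simp add: j)
  qed
  show ?thesis
  proof (cases "k = 0")
    case False
    then show ?thesis using pos assms by simp
  next
    case True
    \<comment> \<open>The case \<open>k = 0\<close> reduces to \<open>k = 1\<close>: the summand
      \<open>r = 0\<close> equals the extra term \<open>single_fps (k - 1) $ n\<close> of the
      recurrence for \<open>k = 1\<close>.\<close>
    have "pair_fps r 0 = pair_fps r 1" for r by (simp add: pair_fps_def)
    then have "(\<Sum>r=0..n. single_fps r $ n + pair_fps r 0 $ n) =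
      single_fps 0 $ n + pair_fps 0 0 $ n + (\<Sum>r=1..n. single_fps r $ n + pair_fps r 1 $ n)"
      by (simp add: sum.atLeast_Suc_atMost)
    also have "pair_fps 0 0 = 0" by (simp add: pair_fps_def)
    finally show ?thesis using True pos[of 1] single_fps_0_eq_1 by simp
  qed
qed

text \<open>Both series contain equally many powers of \<open>C\<close>, except when
  \<open>2 \<le> r\<close> and \<open>k \<le> 1\<close>. Then the left one has the additional term
  \<open>X ^ r * C ^ (r - 1)\<close>, which is \<open>X ^ 2 * avoid_fps (r - 2)\<close>; hence the
  index \<open>n - 1\<close>.\<close>

lemma pair_fps_rec:
  assumes "r \<le> Suc n" "k \<le> r" "1 \<le> r"
  shows "pair_fps r k $ Suc n = pair_fps (r - 1) (k - 1) $ n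
    + (if 2 \<le> r \<and> k \<le> 1 then avoid_fps (r - 2) $ (n - 1) else 0)"
proof -
  obtain r' where r: "r = Suc r'" using assms by (cases r) auto
  show ?thesis
  proof (cases "2 \<le> r \<and> k \<le> 1")
    case True
    then obtain r'' where r2: "r' = Suc r''" using r by (cases r') auto
    then obtain n' where n: "n = Suc n'" using assms r by (cases n) auto
    have "pair_fps r k = X * (pair_fps r' (k - 1) + X * avoid_fps r'')"
      using True by (auto simp: pair_fps_def avoid_fps_def r r2 max_def algebra_simps)
    then show ?thesis using True by (simp add: r r2 n)
  next
    case False
    have "r - max k 1 = r' - max (k - 1) 1" using False assms r by auto
    then have "pair_fps r k = X * pair_fps r' (k - 1)"
      by (simp add: pair_fps_def r algebra_simps)
    then show ?thesis using False r by (auto simp: not_le)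
  qed
qed

section \<open>Ballot numbers as coefficients of Catalan powers\<close>

text \<open>This is the coefficient form of \<open>catalan_fps_power_Suc\<close>. Absorption
  identities express the binomials through \<open>N choose m\<close>.\<close>

lemma ballot_number_rec:
  fixes m j :: nat
  defines "N \<equiv> 2 * m + j + 2"
  shows "real (Suc j) / real (Suc N) * real (Suc N choose Suc m) =
    real j / real N * real (N choose Suc m) + real (j + 2) / real N * real (N choose m)"
proof -
  define b where "b = real (N choose m)"
  have pos: "real m + 1 \<noteq> 0" "real N \<noteq> 0" "real (Suc N) \<noteq> 0" by (auto simp: N_def)
  have "Suc m * (Suc N choose Suc m) = Suc N * (N choose m)"
    by (rule Suc_times_binomial)
  then have "(real m + 1) * real (Suc N choose Suc m) = real (Suc N) * b"
    unfolding b_def by (metis of_nat_Suc of_nat_mult add.commute)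
  then have 1: "real (Suc N choose Suc m) = real (Suc N) * b / (real m + 1)"
    using pos by (simp add: field_simps)
  have "Suc m * (N choose Suc m) = (N - m) * (N choose m)"
    by (simp only: binomial_absorption binomial_absorb_comp)
  then have "(real m + 1) * real (N choose Suc m) = real (N - m) * b"
    unfolding b_def by (metis of_nat_Suc of_nat_mult add.commute)
  moreover have "real (N - m) = real m + real j + 2" by (simp add: N_def)
  ultimately have 2: "real (N choose Suc m) = (real m + real j + 2) * b / (real m + 1)"
    using pos by (simp add: field_simps)
  have N: "real N = 2 * real m + real j + 2" by (simp add: N_def)
  have "real (Suc j) * real N = real j * (real m + real j + 2) + real (j + 2) * (real m + 1)"
    unfolding N by (simp add: algebra_simps)
  then have "real (Suc j) * b / (real m + 1) =
      (real j * (real m + real j + 2) + real (j + 2) * (real m + 1)) * b / (real N * (real m + 1))"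
    using pos by (simp add: divide_simps)
  then show ?thesis unfolding 1 2 b_def[symmetric]
    using pos by (simp add: divide_simps) algebra
qed

text \<open>The induction on \<open>m\<close> needs arbitrary \<open>j\<close>, as it refers to
  \<open>j + 2\<close>; an inner induction on \<open>j\<close> supplies the other term. The case
  \<open>j = m = 0\<close> is excluded because the quotient \<open>0 / 0\<close> is 0 while the
  coefficient is 1.\<close>

lemma catalan_fps_power_nth:
  assumes "0 < j \<or> 0 < m"
  shows "(C ^ j) $ m = real j / real (2 * m + j) * real ((2 * m + j) choose m)"
  using assms
proof (induction m arbitrary: j)
  case 0
  then show ?case by (simp add: fps_power_zeroth catalan_fps_def)
next
  case IH: (Suc m)
  show ?case
  proof (induction j)
    case 0
    then show ?case by simp
  next
    case (Suc j)
    have "(C ^ Suc j) $ Suc m = (C ^ j) $ Suc m + (C ^ (j + 2)) $ m"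
      unfolding catalan_fps_power_Suc by simp
    also have "(C ^ (j + 2)) $ m =
        real (j + 2) / real (2 * m + j + 2) * real ((2 * m + j + 2) choose m)"
      using IH(1)[of "j + 2"] by (simp add: add.assoc)
    also have "(C ^ j) $ Suc m =
        real j / real (2 * m + j + 2) * real ((2 * m + j + 2) choose Suc m)"
      using Suc by (simp only: mult_Suc_right add_ac)
    finally have "(C ^ Suc j) $ Suc m =
        real (Suc j) / real (Suc (2 * m + j + 2)) * real (Suc (2 * m + j + 2) choose Suc m)"
      using ballot_number_rec[of j m] by (simp only:)
    moreover have "Suc (2 * m + j + 2) = 2 * Suc m + Suc j" by simp
    ultimately show ?case by (simp only:)
  qed
qed

lemma X3_C5_closed_form:
  "X ^ 3 * C ^ 5 =
      Abs_fps (\<lambda>n. if n \<ge> 3 then 5 / real (n + 2) * real ((2 * n - 2) choose (n + 1)) else 0)"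
proof (rule fps_ext)
  fix n
  \<comment> \<open>Symmetry and absorption turn
    \<open>5 / (2 * m + 5) * ((2 * m + 5) choose m)\<close> into the claimed coefficient at
    \<open>n = m + 3\<close>.\<close>
  have *: "(C ^ 5) $ m = 5 / real (m + 5) * real ((2 * m + 4) choose (m + 4))" for m
  proof -
    have "Suc (m + 4) * (Suc (2 * m + 4) choose Suc (m + 4)) = Suc (2 * m + 4) * ((2 * m + 4) choose (m + 4))"
      by (rule Suc_times_binomial)
    moreover have "Suc (m + 4) = m + 5" "Suc (2 * m + 4) = 2 * m + 5" by simp_all
    ultimately have "(m + 5) * ((2 * m + 5) choose (m + 5)) = (2 * m + 5) * ((2 * m + 4) choose (m + 4))"
      by (simp only:)
    then have "real (m + 5) * real ((2 * m + 5) choose (m + 5)) = real (2 * m + 5) * real ((2 * m + 4) choose (m + 4))"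
      by (metis of_nat_mult)
    moreover have "(2 * m + 5) choose (m + 5) = (2 * m + 5) choose m"
      using binomial_symmetric[of m "2 * m + 5"] by simp
    ultimately have "real ((2 * m + 4) choose (m + 4)) = real (m + 5) * real ((2 * m + 5) choose m) / real (2 * m + 5)"
      by (simp add: field_simps)
    then show ?thesis by (simp add: catalan_fps_power_nth)
  qed
  show "(X ^ 3 * C ^ 5) $ n = Abs_fps (\<lambda>n. if n \<ge> 3
      then 5 / real (n + 2) * real ((2 * n - 2) choose (n + 1)) else 0) $ n"
  proof (cases "n \<ge> 3")
    case True
    then obtain m where n: "n = m + 3" by (metis add.commute le_Suc_ex)
    have "2 * n - 2 = 2 * m + 4" "n + 1 = m + 4" by (simp_all add: n)
    then show ?thesis using *[of m] by (simp add: fps_X_power_mult_nth n add.commute)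
  qed (simp add: fps_X_power_mult_nth)
qed

section \<open>Ascending pairs and triples in lists\<close>

text \<open>The flag \<open>a\<close> requires the last two positions of an occurrence to be adjacent.\<close>

definition ascents :: "bool \<Rightarrow> nat \<Rightarrow> nat list \<Rightarrow> nat" where
  "ascents a t xs = card {(i, j). i < j \<and> j < length xs \<and> (a \<longrightarrow> j = Suc i) \<and> t < xs ! i \<and> xs ! i < xs ! j}"

definition triples :: "bool \<Rightarrow> nat list \<Rightarrow> nat" where
  "triples a xs = card {(i, j, m). i < j \<and> j < m \<and> m < length xs \<and> (a \<longrightarrow> m = Suc j) \<and>
     xs ! i < xs ! j \<and> xs ! j < xs ! m}"

lemma finite_ascents:
  "finite {(i, j). i < j \<and> j < length xs \<and> (a \<longrightarrow> j = Suc i) \<and> t < xs ! i \<and> xs ! i < xs ! j}"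
  by (rule finite_subset[of _ "{..<length xs} \<times> {..<length xs}"]) auto

lemma finite_triples:
  "finite {(i, j, m). i < j \<and> j < m \<and> m < length xs \<and> (a \<longrightarrow> m = Suc j) \<and>
     xs ! i < xs ! j \<and> xs ! j < xs ! m}"
  by (rule finite_subset[of _ "{..<length xs} \<times> {..<length xs} \<times> {..<length xs}"]) auto

lemma ascents_Nil [simp]: "ascents a t [] = 0"
  and triples_Nil [simp]: "triples a [] = 0"
  by (simp_all add: ascents_def triples_def case_prod_unfold)

lemma ascents_antimono: "t \<le> u \<Longrightarrow> ascents a u xs \<le> ascents a t xs"
  unfolding ascents_def by (rule card_mono[OF finite_ascents]) auto

lemma ascents_adjacent_le: "ascents True t xs \<le> ascents False t xs"
  unfolding ascents_def by (rule card_mono[OF finite_ascents]) auto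

lemma triples_adjacent_le: "triples True xs \<le> triples False xs"
  unfolding triples_def by (rule card_mono[OF finite_triples]) auto

lemma ascents_eq_0:
  assumes "\<And>x. x \<in> set xs \<Longrightarrow> x \<le> t"
  shows "ascents a t xs = 0"
proof -
  have "\<not> t < xs ! i" if "i < j" "j < length xs" for i j
    using assms[of "xs ! i"] that by simp
  then have "{(i, j). i < j \<and> j < length xs \<and> (a \<longrightarrow> j = Suc i) \<and> t < xs ! i \<and> xs ! i < xs ! j} = {}"
    by blast
  then show ?thesis unfolding ascents_def by (simp only: card.empty)
qed

text \<open>The pairs are split by whether they start at \<open>y\<close>. Under the flag, the
  partner of \<open>y\<close> can only be the head of \<open>ys\<close>, hence
  \<open>j = 0\<close>.\<close>

lemma ascents_Cons:
  "ascents a t (y # ys) =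
    (if t < y then card {j. j < length ys \<and> (a \<longrightarrow> j = 0) \<and> y < ys ! j} else 0) + ascents a t ys"
proof -
  let ?S = "{(i, j). i < j \<and> j < length ys \<and> (a \<longrightarrow> j = Suc i) \<and> t < ys ! i \<and> ys ! i < ys ! j}"
  let ?J = "{j. j < length ys \<and> (a \<longrightarrow> j = 0) \<and> y < ys ! j}"
  let ?A = "(\<lambda>j. (0 :: nat, Suc j)) ` (if t < y then ?J else {})"
  let ?B = "(\<lambda>(i, j). (Suc i, Suc j)) ` ?S"
  have "{(i, j). i < j \<and> j < length (y # ys) \<and> (a \<longrightarrow> j = Suc i) \<and> t < (y # ys) ! i \<and> (y # ys) ! i < (y # ys) ! j}
      = ?A \<union> ?B" (is "?L = _")
  proof (intro equalityI subsetI)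
    fix x assume "x \<in> ?L"
    then obtain i j where x: "x = (i, j)" "i < j" "j < Suc (length ys)" "a \<longrightarrow> j = Suc i"
      "t < (y # ys) ! i" "(y # ys) ! i < (y # ys) ! j" by auto
    then obtain j' where "j = Suc j'" by (cases j) auto
    with x show "x \<in> ?A \<union> ?B" by (cases i) (auto simp: image_iff)
  qed (auto split: if_splits)
  moreover have "finite ?A" "finite ?B" "?A \<inter> ?B = {}"
    using finite_ascents[of ys a t] by auto
  ultimately have "ascents a t (y # ys) = card ?A + card ?B"
    unfolding ascents_def by (simp add: card_Un_disjoint)
  moreover have "card ?A = (if t < y then card ?J else 0)"
    by (simp add: card_image inj_on_def)
  moreover have "card ?B = ascents a t ys"
    unfolding ascents_def by (rule card_image) (auto simp: inj_on_def)
  ultimately show ?thesis by simp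
qed

lemma triples_Cons: "triples a (y # ys) = ascents a y ys + triples a ys"
proof -
  let ?S = "{(i, j). i < j \<and> j < length ys \<and> (a \<longrightarrow> j = Suc i) \<and> y < ys ! i \<and> ys ! i < ys ! j}"
  let ?T = "{(i, j, m). i < j \<and> j < m \<and> m < length ys \<and> (a \<longrightarrow> m = Suc j) \<and>
     ys ! i < ys ! j \<and> ys ! j < ys ! m}"
  let ?A = "(\<lambda>(i, j). (0 :: nat, Suc i, Suc j)) ` ?S"
  let ?B = "(\<lambda>(i, j, m). (Suc i, Suc j, Suc m)) ` ?T"
  have "{(i, j, m). i < j \<and> j < m \<and> m < length (y # ys) \<and> (a \<longrightarrow> m = Suc j) \<and>
     (y # ys) ! i < (y # ys) ! j \<and> (y # ys) ! j < (y # ys) ! m} = ?A \<union> ?B" (is "?L = _")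
  proof (intro equalityI subsetI)
    fix x assume "x \<in> ?L"
    then obtain i j m where x: "x = (i, j, m)" "i < j" "j < m" "m < Suc (length ys)" "a \<longrightarrow> m = Suc j"
      "(y # ys) ! i < (y # ys) ! j" "(y # ys) ! j < (y # ys) ! m" by auto
    then obtain j' m' where "j = Suc j'" "m = Suc m'" by (cases j; cases m) auto
    with x show "x \<in> ?A \<union> ?B" by (cases i) (auto simp: image_iff)
  qed auto
  moreover have "finite ?A" "finite ?B" "?A \<inter> ?B = {}"
    using finite_ascents[of ys a y] finite_triples[of ys a] by auto
  ultimately have "triples a (y # ys) = card ?A + card ?B"
    unfolding triples_def by (simp add: card_Un_disjoint)
  moreover have "card ?A = ascents a y ys" "card ?B = triples a ys"
    unfolding ascents_def triples_def by (rule card_image, auto simp: inj_on_def)+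
  ultimately show ?thesis by simp
qed

section \<open>Ranks in a finite set\<close>

text \<open>Serves both as the rank of an element, with 0 for the maximum, and as the size
  \<open>k\<close> of the top part above a threshold that may lie outside \<open>S\<close>.\<close>

definition num_above :: "nat set \<Rightarrow> nat \<Rightarrow> nat" where
  "num_above S t = card {s \<in> S. t < s}"

lemma num_above_le_card: "finite S \<Longrightarrow> num_above S t \<le> card S"
  unfolding num_above_def by (rule card_mono) auto

lemma num_above_antimono: "finite S \<Longrightarrow> u \<le> t \<Longrightarrow> num_above S t \<le> num_above S u"
  unfolding num_above_def by (rule card_mono) auto

lemma num_above_less_iff:
  assumes "finite S" "y \<in> S"
  shows "num_above S y < num_above S t \<longleftrightarrow> t < y"
proof
  assume "t < y"
  then have "{s \<in> S. y < s} \<subset> {s \<in> S. t < s}" using assms by auto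
  then show "num_above S y < num_above S t"
    unfolding num_above_def using assms by (intro psubset_card_mono) auto
next
  assume "num_above S y < num_above S t"
  then show "t < y" using num_above_antimono[OF assms(1), of y t] by (meson leD leI)
qed

lemma num_above_remove:
  assumes "finite S" "y \<in> S"
  shows "num_above (S - {y}) t = (if t < y then num_above S t - 1 else num_above S t)"
proof -
  have "{s \<in> S - {y}. t < s} = {s \<in> S. t < s} - {y}" by auto
  then show ?thesis unfolding num_above_def using assms by (auto simp: card_Diff_singleton)
qed

text \<open>Larger elements have smaller ranks, so \<open>num_above S\<close> is a bijection from
  \<open>S\<close> onto \<open>{..<card S}\<close>.\<close>

lemma sum_num_above:
  fixes \<phi> :: "nat \<Rightarrow> 'a :: comm_monoid_add"
  assumes "finite S"
  shows "(\<Sum>y\<in>S. \<phi> (num_above S y)) = (\<Sum>r<card S. \<phi> r)"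
proof -
  have inj: "inj_on (num_above S) S"
    using num_above_less_iff[OF assms] by (intro inj_onI) (metis less_irrefl nat_neq_iff)
  have "num_above S ` S \<subseteq> {..<card S}"
    unfolding num_above_def using assms by (auto intro!: psubset_card_mono)
  then have "num_above S ` S = {..<card S}"
    using inj by (intro card_subset_eq) (auto simp: card_image)
  then show ?thesis using sum.reindex[OF inj, of \<phi>] by simp
qed

text \<open>Common shape of the recurrences for avoiders and single occurrences: a first entry up to
  \<open>t\<close> has rank at least \<open>num_above S t\<close> and contributes by rank; one above
  \<open>t\<close> contributes only if it is the maximum of \<open>S\<close>.\<close>

lemma sum_num_above_threshold:
  fixes \<phi> :: "nat \<Rightarrow> 'a :: comm_monoid_add"
  assumes "finite S" "card S = Suc n"
    and "\<And>y. y \<in> S \<Longrightarrow> y \<le> t \<Longrightarrow> F y = \<phi> (num_above S y)"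
    and "\<And>y. y \<in> S \<Longrightarrow> t < y \<Longrightarrow> F y = (if num_above S y = 0 then \<psi> else 0)"
  shows "(\<Sum>y\<in>S. F y) = (if 0 < num_above S t then \<psi> else 0) + (\<Sum>r=num_above S t..n. \<phi> r)"
proof -
  let ?k = "num_above S t"
  define \<chi> where "\<chi> r = (if r < ?k then (if r = 0 then \<psi> else 0) else \<phi> r)" for r
  have "(\<Sum>y\<in>S. F y) = (\<Sum>y\<in>S. \<chi> (num_above S y))"
  proof (intro sum.cong refl)
    fix y assume y: "y \<in> S"
    then show "F y = \<chi> (num_above S y)"
      using num_above_less_iff[OF assms(1) y, of t] assms(3,4)[OF y] by (auto simp: \<chi>_def not_less)
  qed
  also have "\<dots> = (\<Sum>r<Suc n. \<chi> r)"
    using sum_num_above[OF assms(1)] assms(2) by simp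
  also have "{..<Suc n} = {..<?k} \<union> {?k..n}"
    using num_above_le_card[OF assms(1), of t] assms(2) by auto
  also have "sum \<chi> ({..<?k} \<union> {?k..n}) = sum \<chi> {..<?k} + sum \<chi> {?k..n}"
    by (rule sum.union_disjoint) auto
  also have "sum \<chi> {..<?k} = (\<Sum>r<?k. if r = 0 then \<psi> else 0)"
    by (intro sum.cong) (auto simp: \<chi>_def)
  also have "\<dots> = (if 0 < ?k then \<psi> else 0)" by (simp add: sum.delta)
  also have "sum \<chi> {?k..n} = sum \<phi> {?k..n}"
    by (intro sum.cong) (auto simp: \<chi>_def)
  finally show ?thesis .
qed

section \<open>Splitting off the first entry of a permutation\<close>

lemma card_permutations_of_set_first:
  assumes "finite S" "S \<noteq> {}"
  shows "card {xs \<in> permutations_of_set S. P xs} =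
    (\<Sum>y\<in>S. card {ys \<in> permutations_of_set (S - {y}). P (y # ys)})"
proof -
  have "{xs \<in> permutations_of_set S. P xs} =
      (\<Union>y\<in>S. (#) y ` {ys \<in> permutations_of_set (S - {y}). P (y # ys)})"
    using assms by (subst permutations_of_set_nonempty) auto
  also have "card \<dots> = (\<Sum>y\<in>S. card ((#) y ` {ys \<in> permutations_of_set (S - {y}). P (y # ys)}))"
    using assms by (intro card_UN_disjoint) auto
  finally show ?thesis by (simp add: card_image)
qed

lemma card_positions_above:
  assumes "ys \<in> permutations_of_set (S - {y})"
  shows "card {j. j < length ys \<and> y < ys ! j} = num_above S y"
proof -
  have ys: "set ys = S - {y}" "distinct ys" using permutations_of_setD[OF assms] .
  have "inj_on ((!) ys) {j. j < length ys \<and> y < ys ! j}"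
    using ys by (auto simp: inj_on_def nth_eq_iff_index_eq)
  then have "card {j. j < length ys \<and> y < ys ! j} = card ((!) ys ` {j. j < length ys \<and> y < ys ! j})"
    by (simp add: card_image)
  also have "(!) ys ` {j. j < length ys \<and> y < ys ! j} = {s \<in> set ys. y < s}"
    by (auto simp: in_set_conv_nth)
  also have "\<dots> = {s \<in> S. y < s}" using ys by auto
  finally show ?thesis by (simp add: num_above_def)
qed

text \<open>Without adjacency, every later entry larger than \<open>y\<close> forms a pair with it,
  so their number is the rank of \<open>y\<close> whatever the order of \<open>ys\<close>.\<close>

lemma ascents_Cons_permutation:
  assumes "ys \<in> permutations_of_set (S - {y})"
  shows "ascents False t (y # ys) = (if t < y then num_above S y else 0) + ascents False t ys"
  using card_positions_above[OF assms] by (simp add: ascents_Cons)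

section \<open>The three classes of permutations and their cardinalities\<close>

text \<open>On a permutation, \<open>ascents False t xs = 0\<close> says that the entries above
  \<open>t\<close> appear in decreasing order.\<close>

definition avoiders :: "nat set \<Rightarrow> nat \<Rightarrow> nat list set" where
  "avoiders S t = {xs \<in> permutations_of_set S. triples False xs = 0 \<and> ascents False t xs = 0}"

text \<open>The two counts equal to 1 say together that the only ascending pair above
  \<open>u\<close> occupies adjacent positions.\<close>

definition pair_perms :: "nat set \<Rightarrow> nat \<Rightarrow> nat \<Rightarrow> nat list set" where
  "pair_perms S u t = {xs \<in> permutations_of_set S. triples False xs = 0 \<and>
     ascents False u xs = 1 \<and> ascents True u xs = 1 \<and> ascents False t xs = 0}"

definition single_perms :: "nat set \<Rightarrow> nat \<Rightarrow> nat list set" where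
  "single_perms S t = {xs \<in> permutations_of_set S. triples False xs = 1 \<and>
     triples True xs = 1 \<and> ascents False t xs = 0}"

lemma card_avoiders:
  assumes "finite S"
  shows "real (card (avoiders S t)) = avoid_fps (num_above S t) $ card S"
  using assms
proof (induction "card S" arbitrary: S t)
  case 0
  then have "S = {}" by simp
  moreover have "avoiders {} t = {[]}" by (auto simp: avoiders_def)
  ultimately show ?case by (simp add: num_above_def avoid_fps_0)
next
  case (Suc n)
  let ?Q = "\<lambda>y. {ys \<in> permutations_of_set (S - {y}). triples False (y # ys) = 0 \<and> ascents False t (y # ys) = 0}"
  have ne: "S \<noteq> {}" and n: "\<And>y. y \<in> S \<Longrightarrow> card (S - {y}) = n" using Suc by auto
  have IH: "real (card (avoiders (S - {y}) u)) = avoid_fps (num_above (S - {y}) u) $ n" if "y \<in> S" for y u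
    using Suc n that by simp
  have "real (card (avoiders S t)) = (\<Sum>y\<in>S. real (card (?Q y)))"
    unfolding avoiders_def using card_permutations_of_set_first[OF Suc.prems ne] by simp
  also have "\<dots> = (if 0 < num_above S t then avoid_fps (num_above S t - 1) $ n else 0)
      + (\<Sum>r=num_above S t..n. avoid_fps r $ n)"
  proof (rule sum_num_above_threshold[OF Suc.prems Suc.hyps(2)[symmetric]])
    fix y assume y: "y \<in> S" "y \<le> t"
    \<comment> \<open>Avoiding occurrences that start at \<open>y\<close> means having no ascending
      pair above \<open>y\<close>; as \<open>y \<le> t\<close>, this includes the condition for
      \<open>t\<close>.\<close>
    have "?Q y = avoiders (S - {y}) y"
      unfolding avoiders_def
    proof (rule Collect_cong, rule conj_cong[OF refl])
      fix ys assume "ys \<in> permutations_of_set (S - {y})"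
      from ascents_Cons_permutation[OF this] show "triples False (y # ys) = 0 \<and> ascents False t (y # ys) = 0 \<longleftrightarrow>
          triples False ys = 0 \<and> ascents False y ys = 0"
        using y ascents_antimono[OF y(2), of False ys] by (auto simp: triples_Cons)
    qed
    then show "real (card (?Q y)) = avoid_fps (num_above S y) $ n"
      using IH y Suc.prems by (simp add: num_above_remove)
  next
    fix y assume y: "y \<in> S" "t < y"
    \<comment> \<open>Any larger entry would form with \<open>y\<close> a pair above
      \<open>t\<close>, so \<open>y\<close> must be the maximum of \<open>S\<close>.\<close>
    have "?Q y = {ys \<in> permutations_of_set (S - {y}).
        num_above S y = 0 \<and> triples False ys = 0 \<and> ascents False t ys = 0}"
    proof (rule Collect_cong, rule conj_cong[OF refl])
      fix ys assume "ys \<in> permutations_of_set (S - {y})"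
      from ascents_Cons_permutation[OF this] show "triples False (y # ys) = 0 \<and> ascents False t (y # ys) = 0 \<longleftrightarrow>
          num_above S y = 0 \<and> triples False ys = 0 \<and> ascents False t ys = 0"
        using y ascents_antimono[of t y False ys] by (auto simp: triples_Cons)
    qed
    also have "\<dots> = (if num_above S y = 0 then avoiders (S - {y}) t else {})"
      by (simp add: avoiders_def)
    finally have "?Q y = \<dots>" .
    then show "real (card (?Q y)) = (if num_above S y = 0 then avoid_fps (num_above S t - 1) $ n else 0)"
      using IH y Suc.prems by (simp add: num_above_remove)
  qed
  also have "\<dots> = avoid_fps (num_above S t) $ card S"
    using avoid_fps_rec[of "num_above S t" n] num_above_le_card[OF Suc.prems, of t] Suc.hyps(2) by simp
  finally show ?case .
qed


text \<open>If exactly one element \<open>M\<close> exceeds the first entry \<open>y\<close>, the only ascent starting at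
  \<open>y\<close> is adjacent iff \<open>M\<close> comes second.\<close>

lemma card_pair_perms_second:
  assumes "finite S" "y \<in> S" "u < y" "num_above S y = 1"
  shows "real (card {ys \<in> permutations_of_set (S - {y}). triples False ys = 0 \<and>
      ascents False u ys = 0 \<and> card {j. j < length ys \<and> j = 0 \<and> y < ys ! j} = 1}) =
    (if 2 \<le> card S then avoid_fps (num_above S u - 2) $ (card S - 2) else 0)"
    (is "real (card ?Q) = _")
proof -
  obtain M where M: "{s \<in> S. y < s} = {M}"
    using assms(4) unfolding num_above_def by (auto simp: card_1_singleton_iff)
  have "M \<in> S" "y < M" using M by blast+
  have uniq: "s = M" if "s \<in> S" "y < s" for s using M that by blast
  have two: "2 \<le> card S"
  proof -
    have "card {y, M} \<le> card S" using assms \<open>M \<in> S\<close> by (intro card_mono) auto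
    then show ?thesis using \<open>y < M\<close> by simp
  qed
  let ?R = "S - {y} - {M}"
  have "{s \<in> S - {y}. M < s} = {}" using uniq \<open>y < M\<close> by fastforce
  then have top: "num_above (S - {y}) M = 0" unfolding num_above_def by (simp only: card.empty)
  \<comment> \<open>As the maximum of \<open>S - {y}\<close>, \<open>M\<close> starts no ascending
    pair when placed first.\<close>
  have cons: "triples False (M # zs) = 0 \<and> ascents False u (M # zs) = 0 \<longleftrightarrow>
      triples False zs = 0 \<and> ascents False u zs = 0" if "zs \<in> permutations_of_set ?R" for zs
    using ascents_Cons_permutation[OF that, of u] top ascents_antimono[of u M False zs]
      assms \<open>y < M\<close> by (auto simp: triples_Cons)
  have "?Q = (#) M ` avoiders ?R u"
  proof (intro equalityI subsetI)
    fix ys assume ys: "ys \<in> ?Q"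
    have "card {j. j < length ys \<and> j = 0 \<and> y < ys ! j} = 1" using ys by blast
    then obtain i where "{j. j < length ys \<and> j = 0 \<and> y < ys ! j} = {i}" by (rule card_1_singletonE)
    then have "i \<in> {j. j < length ys \<and> j = 0 \<and> y < ys ! j}" by blast
    then have "0 < length ys" "y < ys ! 0" by auto
    then obtain z zs where z: "ys = z # zs" "y < z" by (cases ys) auto
    have "set ys = S - {y}" "distinct ys" using ys by (auto dest: permutations_of_setD)
    moreover from this have "z = M" using z by (intro uniq) auto
    ultimately have "z = M" "zs \<in> permutations_of_set ?R" using z by (auto simp: permutations_of_set_def)
    then show "ys \<in> (#) M ` avoiders ?R u"
      using ys z(1) cons[of zs] by (auto simp: avoiders_def)
  next
    fix ys assume "ys \<in> (#) M ` avoiders ?R u"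
    then obtain zs where zs: "ys = M # zs" "zs \<in> permutations_of_set ?R"
      "triples False zs = 0" "ascents False u zs = 0" by (auto simp: avoiders_def)
    have "M # zs \<in> permutations_of_set (S - {y})"
      using zs(2) \<open>M \<in> S\<close> \<open>y < M\<close> by (auto simp: permutations_of_set_def)
    moreover have "{j. j < length ys \<and> j = 0 \<and> y < ys ! j} = {0}"
      using zs \<open>y < M\<close> by auto
    ultimately show "ys \<in> ?Q" using zs cons[of zs] by simp
  qed
  then have "real (card ?Q) = real (card (avoiders ?R u))" by (simp add: card_image)
  also have "\<dots> = avoid_fps (num_above ?R u) $ card ?R"
    using assms by (simp add: card_avoiders)
  also have "card ?R = card S - 2" using assms \<open>M \<in> S\<close> \<open>y < M\<close> by simp
  also have "num_above ?R u = num_above S u - 2"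
    using assms \<open>M \<in> S\<close> \<open>y < M\<close> by (simp add: num_above_remove)
  finally show ?thesis using two by simp
qed

lemma card_pair_perms:
  assumes "finite S" "u \<le> t"
  shows "real (card (pair_perms S u t)) = pair_fps (num_above S u) (num_above S t) $ card S"
  using assms
proof (induction "card S" arbitrary: S)
  case 0
  then have "S = {}" by simp
  moreover have "pair_perms {} u t = {}" by (auto simp: pair_perms_def)
  ultimately show ?case by (simp add: num_above_def pair_fps_def)
next
  case (Suc n)
  note fin = Suc.prems(1)
  let ?r = "num_above S u" and ?k = "num_above S t"
  let ?P = "\<lambda>xs. triples False xs = 0 \<and> ascents False u xs = 1 \<and> ascents True u xs = 1 \<and> ascents False t xs = 0"
  let ?Q = "\<lambda>y. {ys \<in> permutations_of_set (S - {y}). ?P (y # ys)}"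
  have ne: "S \<noteq> {}" and n: "\<And>y. y \<in> S \<Longrightarrow> card (S - {y}) = n" using Suc by auto
  \<comment> \<open>Contribution by the rank \<open>q\<close> of the first entry. A maximum above
    \<open>u\<close> leaves a smaller problem; truncated subtraction in \<open>?k - 1\<close> also
    covers \<open>?k = 0\<close>. Rank 1 needs the maximum next and \<open>y \<le> t\<close>, that
    is \<open>?k \<le> 1\<close>. Higher ranks above \<open>u\<close> create at least two
    pairs.\<close>
  define \<phi> where "\<phi> q = (if q = 0 \<and> 1 \<le> ?r then pair_fps (?r - 1) (?k - 1) $ n
      else if q = 1 \<and> 2 \<le> ?r \<and> ?k \<le> 1 then avoid_fps (?r - 2) $ (n - 1) else 0)" for q :: nat
  have "real (card (?Q y)) = \<phi> (num_above S y)" if y: "y \<in> S" for y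
  proof -
    let ?J = "\<lambda>ys. card {j. j < length ys \<and> j = 0 \<and> y < ys ! j}"
    have J: "?J ys \<le> num_above S y" if "ys \<in> permutations_of_set (S - {y})" for ys
      unfolding card_positions_above[OF that, symmetric] by (rule card_mono) auto
    have rank: "num_above S y < ?r \<longleftrightarrow> u < y" "num_above S y < ?k \<longleftrightarrow> t < y"
      using num_above_less_iff[OF fin y] by auto
    consider "y \<le> u" | "u < y" "num_above S y = 0" | "u < y" "num_above S y = 1"
      | "u < y" "2 \<le> num_above S y" by linarith
    then show ?thesis
    proof cases
      case 1
      \<comment> \<open>The required pair above \<open>u\<close> would also lie above
        \<open>y\<close> and form an occurrence with it.\<close>
      then have "\<not> ?P (y # ys)" if "ys \<in> permutations_of_set (S - {y})" for ys
        using ascents_Cons_permutation[OF that, of u] ascents_antimono[of y u False ys]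
        by (auto simp: triples_Cons)
      then have "?Q y = {}" by blast
      then show ?thesis using 1 rank by (auto simp: \<phi>_def)
    next
      case 2
      have "?Q y = pair_perms (S - {y}) u t"
        unfolding pair_perms_def
      proof (rule Collect_cong, rule conj_cong[OF refl])
        fix ys assume ys: "ys \<in> permutations_of_set (S - {y})"
        have "ascents True u (y # ys) = ascents True u ys"
          using J[OF ys] 2 by (simp add: ascents_Cons)
        moreover have "ascents False y ys = 0"
          using 2 fin permutations_of_setD(1)[OF ys]
          by (intro ascents_eq_0) (auto simp: num_above_def not_less)
        ultimately show "?P (y # ys) = ?P ys"
          using ascents_Cons_permutation[OF ys, of u] ascents_Cons_permutation[OF ys, of t] 2
          by (simp add: triples_Cons)
      qed
      then show ?thesis
        using Suc.hyps(1)[of "S - {y}"] n[OF y] fin Suc.prems(2) y 2 rank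
        by (auto simp: \<phi>_def num_above_remove)
    next
      case 3
      \<comment> \<open>The only pair above \<open>u\<close> is the one starting at
        \<open>y\<close>. It must not lie above \<open>t\<close>, and the rest has no pair above
        \<open>u\<close>.\<close>
      have "?Q y = {ys \<in> permutations_of_set (S - {y}). y \<le> t \<and> triples False ys = 0 \<and>
          ascents False u ys = 0 \<and> ?J ys = 1}"
      proof (rule Collect_cong, rule conj_cong[OF refl])
        fix ys assume ys: "ys \<in> permutations_of_set (S - {y})"
        have "ascents True u (y # ys) = ?J ys + ascents True u ys"
          using 3 by (simp add: ascents_Cons)
        then show "?P (y # ys) \<longleftrightarrow> y \<le> t \<and> triples False ys = 0 \<and> ascents False u ys = 0 \<and> ?J ys = 1"
          using ascents_Cons_permutation[OF ys, of u] ascents_Cons_permutation[OF ys, of t] 3 J[OF ys]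
            ascents_antimono[of u y False ys] ascents_antimono[of u t False ys] Suc.prems(2)
            ascents_adjacent_le[of u ys]
          by (auto simp: triples_Cons not_less)
      qed
      moreover have "card S - 2 = n - 1" using Suc.hyps(2) by simp
      ultimately show ?thesis
        using card_pair_perms_second[OF fin y 3] 3 rank num_above_le_card[OF fin, of u] Suc.hyps(2)
        by (cases "y \<le> t") (auto simp: \<phi>_def)
    next
      case 4
      then have "\<not> ?P (y # ys)" if "ys \<in> permutations_of_set (S - {y})" for ys
        using ascents_Cons_permutation[OF that, of u] by auto
      then have "?Q y = {}" by blast
      then show ?thesis using 4 by (auto simp: \<phi>_def)
    qed
  qed
  then have "real (card (pair_perms S u t)) = (\<Sum>y\<in>S. \<phi> (num_above S y))"
    unfolding pair_perms_def using card_permutations_of_set_first[OF fin ne, of ?P] by simp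
  also have "\<dots> = (\<Sum>q<Suc n. \<phi> q)"
    using sum_num_above[OF fin] Suc.hyps(2) by simp
  also have "\<dots> = pair_fps ?r ?k $ Suc n"
  proof (cases "1 \<le> ?r")
    case False
    then show ?thesis
      using num_above_antimono[OF fin Suc.prems(2)] by (simp add: \<phi>_def pair_fps_def)
  next
    case True
    have r: "?r \<le> Suc n" using num_above_le_card[OF fin, of u] Suc.hyps(2) by simp
    have "(\<Sum>q<Suc n. \<phi> q) = \<phi> 0 + (\<Sum>q<n. \<phi> (Suc q))" by (rule sum.lessThan_Suc_shift)
    also have "(\<Sum>q<n. \<phi> (Suc q)) = (\<Sum>q<n. if q = 0 then \<phi> 1 else 0)"
      by (intro sum.cong) (auto simp: \<phi>_def)
    \<comment> \<open>For \<open>n = 0\<close> the sum is empty, and \<open>\<phi> 1\<close> is 0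
      because \<open>2 \<le> ?r\<close> contradicts \<open>?r \<le> Suc n\<close>.\<close>
    also have "\<dots> = \<phi> 1" using r by (auto simp: \<phi>_def)
    finally show ?thesis
      using pair_fps_rec[OF r num_above_antimono[OF fin Suc.prems(2)] True] True
      by (simp add: \<phi>_def)
  qed
  finally show ?case using Suc.hyps(2) by simp
qed

lemma card_single_perms:
  assumes "finite S"
  shows "real (card (single_perms S t)) = single_fps (num_above S t) $ card S"
  using assms
proof (induction "card S" arbitrary: S t)
  case 0
  then have "S = {}" by simp
  moreover have "single_perms {} t = {}" by (auto simp: single_perms_def)
  ultimately show ?case by (simp add: num_above_def single_fps_def)
next
  case (Suc n)
  let ?P = "\<lambda>xs. triples False xs = 1 \<and> triples True xs = 1 \<and> ascents False t xs = 0"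
  let ?Q = "\<lambda>y. {ys \<in> permutations_of_set (S - {y}). ?P (y # ys)}"
  let ?k = "num_above S t"
  have ne: "S \<noteq> {}" and n: "\<And>y. y \<in> S \<Longrightarrow> card (S - {y}) = n" using Suc by auto
  have IH: "real (card (single_perms (S - {y}) u)) = single_fps (num_above (S - {y}) u) $ n" if "y \<in> S" for y u
    using Suc n that by simp
  have "real (card (single_perms S t)) = (\<Sum>y\<in>S. real (card (?Q y)))"
    unfolding single_perms_def using card_permutations_of_set_first[OF Suc.prems ne, of ?P] by simp
  also have "\<dots> = (if 0 < ?k then single_fps (?k - 1) $ n else 0)
      + (\<Sum>r=?k..n. single_fps r $ n + pair_fps r ?k $ n)"
  proof (rule sum_num_above_threshold[OF Suc.prems Suc.hyps(2)[symmetric]])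
    fix y assume y: "y \<in> S" "y \<le> t"
    \<comment> \<open>The occurrence lies either within \<open>ys\<close> or starts at
      \<open>y\<close>. In the first case no pair above \<open>y\<close> remains, hence none above
      \<open>t\<close>; in the second the condition for \<open>t\<close> has to be kept.\<close>
    have "?Q y = {ys \<in> permutations_of_set (S - {y}).
        (triples False ys = 1 \<and> triples True ys = 1 \<and> ascents False y ys = 0) \<or>
        (triples False ys = 0 \<and> ascents False y ys = 1 \<and> ascents True y ys = 1 \<and> ascents False t ys = 0)}"
      (is "_ = {ys \<in> _. ?R ys}")
    proof (rule Collect_cong, rule conj_cong[OF refl])
      fix ys assume "ys \<in> permutations_of_set (S - {y})"
      from ascents_Cons_permutation[OF this] show "?P (y # ys) \<longleftrightarrow> ?R ys"
        using y ascents_antimono[OF y(2), of False ys] ascents_adjacent_le[of y ys] triples_adjacent_le[of ys]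
        by (auto simp: triples_Cons add_is_1)
    qed
    also have "\<dots> = single_perms (S - {y}) y \<union> pair_perms (S - {y}) y t"
      by (auto simp: single_perms_def pair_perms_def)
    also have "card \<dots> = card (single_perms (S - {y}) y) + card (pair_perms (S - {y}) y t)"
      by (rule card_Un_disjoint) (auto simp: single_perms_def pair_perms_def)
    finally show "real (card (?Q y)) = single_fps (num_above S y) $ n + pair_fps (num_above S y) ?k $ n"
      using IH[OF y(1)] card_pair_perms[of "S - {y}" y t] n y Suc.prems by (simp add: num_above_remove)
  next
    fix y assume y: "y \<in> S" "t < y"
    have "?Q y = {ys \<in> permutations_of_set (S - {y}). num_above S y = 0 \<and> ?P ys}"
    proof (rule Collect_cong, rule conj_cong[OF refl])
      fix ys assume "ys \<in> permutations_of_set (S - {y})"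
      from ascents_Cons_permutation[OF this] show "?P (y # ys) \<longleftrightarrow> num_above S y = 0 \<and> ?P ys"
        using y ascents_antimono[of t y False ys] ascents_adjacent_le[of y ys] by (auto simp: triples_Cons)
    qed
    also have "\<dots> = (if num_above S y = 0 then single_perms (S - {y}) t else {})"
      by (simp add: single_perms_def)
    finally have "?Q y = \<dots>" .
    then show "real (card (?Q y)) = (if num_above S y = 0 then single_fps (?k - 1) $ n else 0)"
      using IH y Suc.prems by (simp add: num_above_remove)
  qed
  also have "\<dots> = single_fps ?k $ card S"
    using single_fps_rec[of ?k n] num_above_le_card[OF Suc.prems, of t] Suc.hyps(2) by simp
  finally show ?case .
qed

section \<open>From permutation functions to lists\<close>

text \<open>Injectivity uses that a permutation of \<open>{1..n}\<close> fixes all other numbers;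
  surjectivity follows since both sets have the same cardinality.\<close>

lemma bij_betw_permutes_lists:
  "bij_betw (\<lambda>p. map p [1..<Suc n]) {p. p permutes {1..n}} (permutations_of_set {1..n})"
  unfolding bij_betw_def
proof
  show inj: "inj_on (\<lambda>p. map p [1..<Suc n]) {p. p permutes {1..n}}"
  proof (rule inj_onI, rule ext)
    fix p q x assume pq: "p \<in> {p. p permutes {1..n}}" "q \<in> {p. p permutes {1..n}}"
      "map p [1..<Suc n] = map q [1..<Suc n]"
    have "p x = q x" if "x \<in> {1..n}"
      using pq(3) that by (auto simp del: upt_Suc)
    moreover have "p x = q x" if "x \<notin> {1..n}"
      using pq(1,2) that by (metis mem_Collect_eq permutes_not_in)
    ultimately show "p x = q x" by blast
  qed
  have "(\<lambda>p. map p [1..<Suc n]) ` {p. p permutes {1..n}} \<subseteq> permutations_of_set {1..n}"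
  proof clarify
    fix p assume p: "p permutes {1..n}"
    have "{1..<Suc n} = {1..n}" by auto
    then show "map p [1..<Suc n] \<in> permutations_of_set {1..n}"
      using permutes_image[OF p] permutes_inj_on[OF p]
      by (auto simp: permutations_of_set_def distinct_map simp del: upt_Suc)
  qed
  moreover have "card ((\<lambda>p. map p [1..<Suc n]) ` {p. p permutes {1..n}}) = card (permutations_of_set {1..n})"
    using card_image[OF inj] by (simp add: card_permutations)
  ultimately show "(\<lambda>p. map p [1..<Suc n]) ` {p. p permutes {1..n}} = permutations_of_set {1..n}"
    by (intro card_subset_eq) auto
qed

lemma card_occurrences_eq_triples:
  "card {(i, j, m). 1 \<le> i \<and> i < j \<and> j < m \<and> m \<le> n \<and> p i < p j \<and> p j < p m \<and> (a \<longrightarrow> m = j + 1)}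
    = triples a (map p [1..<Suc n])"
proof -
  let ?T = "{(i, j, m). i < j \<and> j < m \<and> m < n \<and> (a \<longrightarrow> m = Suc j) \<and>
     p (Suc i) < p (Suc j) \<and> p (Suc j) < p (Suc m)}"
  have nth: "map p [1..<Suc n] ! i = p (Suc i)" if "i < n" for i
    using that by (simp del: upt_Suc)
  have "{(i, j, m). 1 \<le> i \<and> i < j \<and> j < m \<and> m \<le> n \<and> p i < p j \<and> p j < p m \<and> (a \<longrightarrow> m = j + 1)}
      = (\<lambda>(i, j, m). (Suc i, Suc j, Suc m)) ` ?T" (is "?L = _")
  proof (intro equalityI subsetI)
    fix x assume "x \<in> ?L"
    then obtain i j m where x: "x = (i, j, m)" "1 \<le> i" "i < j" "j < m" "m \<le> n" "p i < p j" "p j < p m"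
      "a \<longrightarrow> m = j + 1" by auto
    moreover from x obtain i' j' m' where "i = Suc i'" "j = Suc j'" "m = Suc m'"
      by (metis One_nat_def Suc_le_D less_imp_Suc_add)
    ultimately show "x \<in> (\<lambda>(i, j, m). (Suc i, Suc j, Suc m)) ` ?T"
      by (intro image_eqI[of _ _ "(i', j', m')"]) auto
  qed auto
  moreover have "card ((\<lambda>(i, j, m). (Suc i, Suc j, Suc m)) ` ?T) = card ?T"
    by (rule card_image) (auto simp: inj_on_def)
  moreover have "triples a (map p [1..<Suc n]) = card ?T"
    unfolding triples_def by (rule arg_cong[of _ _ card]) (auto simp: nth simp del: upt_Suc)
  ultimately show ?thesis by simp
qed

text \<open>No entry exceeds \<open>n\<close>, so the threshold \<open>n\<close> gives the case
  \<open>k = 0\<close> of unrestricted permutations.\<close>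

lemma card_single_occurrence_perms:
  "card {p \<in> perms_with_occ n 1 occ_1_23. occ_1_2_3 n p = 1} = card (single_perms {1..n} n)"
proof -
  let ?f = "\<lambda>p. map p [1..<Suc n]"
  have occ: "occ_1_2_3 n p = triples False (?f p)" "occ_1_23 n p = triples True (?f p)" for p
    unfolding card_occurrences_eq_triples[symmetric] occ_1_2_3_def occ_1_23_def by simp_all
  have zero: "ascents False n xs = 0" if "xs \<in> permutations_of_set {1..n}" for xs
    using permutations_of_setD(1)[OF that] by (intro ascents_eq_0) auto
  have "bij_betw ?f {p \<in> {p. p permutes {1..n}}. triples True (?f p) = 1 \<and> triples False (?f p) = 1}
      {xs \<in> permutations_of_set {1..n}. triples True xs = 1 \<and> triples False xs = 1}"
    by (rule bij_betw_Collect[OF bij_betw_permutes_lists]) simp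
  then have "card {p \<in> {p. p permutes {1..n}}. triples True (?f p) = 1 \<and> triples False (?f p) = 1}
      = card {xs \<in> permutations_of_set {1..n}. triples True xs = 1 \<and> triples False xs = 1}"
    by (rule bij_betw_same_card)
  also have "{xs \<in> permutations_of_set {1..n}. triples True xs = 1 \<and> triples False xs = 1}
      = single_perms {1..n} n"
    using zero by (auto simp: single_perms_def)
  finally show ?thesis by (simp add: perms_with_occ_def occ conj_assoc del: upt_Suc)
qed

theorem theorem8:
  fixes b :: "nat \<Rightarrow> nat"
  assumes "\<And>n. n \<ge> 3 \<Longrightarrow>
    b n = card {p \<in> perms_with_occ n 1 occ_1_23. occ_1_2_3 n p = 1}"
  shows "Abs_fps (\<lambda>n. if n \<ge> 3 then real (b n) else 0) = fps_X ^ 3 * catalan_fps ^ 5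
    \<and> fps_X ^ 3 * catalan_fps ^ 5 =
      Abs_fps (\<lambda>n. if n \<ge> 3 then 5 / real (n + 2) * real ((2 * n - 2) choose (n + 1)) else 0)"
proof
  show "Abs_fps (\<lambda>n. if n \<ge> 3 then real (b n) else 0) = fps_X ^ 3 * catalan_fps ^ 5"
  proof (rule fps_ext)
    fix n
    have "num_above {1..n} n = 0" by (auto simp: num_above_def card_eq_0_iff)
    then have "real (card (single_perms {1..n} n)) = (X ^ 3 * C ^ 5) $ n"
      using card_single_perms[of "{1..n}" n] by (simp add: single_fps_0)
    \<comment> \<open>For \<open>n < 3\<close> both coefficients are 0, the right one because of the
      factor \<open>X ^ 3\<close>.\<close>
    then show "Abs_fps (\<lambda>n. if n \<ge> 3 then real (b n) else 0) $ n = (fps_X ^ 3 * catalan_fps ^ 5) $ n"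
      using assms[of n] card_single_occurrence_perms[of n] fps_X_power_mult_nth_less[of n 3 "C ^ 5"] by simp
  qed
qed (rule X3_C5_closed_form)

end
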